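(* Let $p$ be a prime. There exist an infinite set $Q$ of powers of $p$ and, for each $q \in Q$, a subset $E_q \subseteq \mathbb{F}_q^2$ such that $|E_q| = q^{4/3}$ and $\Delta(E_q) \neq \mathbb{F}_q$. Moreover, these can be chosen so that $\limsup_{q \in Q,\, q \to \infty} |\Delta(E_q)|/q \leq 1/2$.
   Context: $\mathbb{F}_q$ denotes the finite field with $q$ elements. For $E \subseteq \mathbb{F}_q^2$, the distance set of $E$ is $\Delta(E) = \{ (x-y)\cdot(x-y) : x, y \in E\}$, where for $z=(z_1,z_2)\in\mathbb{F}_q^2$ one sets $z\cdot z = z_1^2+z_2^2$. *)

theory Defs
  imports
    "HOL-Computational_Algebra.Primes"
    "HOL-Library.Extended_Real"
    "HOL-Algebra.Ring"
begin

definition sq_norm :: "('a, 'm) ring_scheme \<Rightarrow> 'a \<times> 'a \<Rightarrow> 'a" where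
  "sq_norm R z = fst z [^]\<^bsub>R\<^esub> (2::nat) \<oplus>\<^bsub>R\<^esub> snd z [^]\<^bsub>R\<^esub> (2::nat)"

definition plane :: "('a, 'm) ring_scheme \<Rightarrow> ('a \<times> 'a) set" where
  "plane R = carrier R \<times> carrier R"

definition distance_set :: "('a, 'm) ring_scheme \<Rightarrow> ('a \<times> 'a) set \<Rightarrow> 'a set" where
  "distance_set R E =
    {sq_norm R (fst x \<ominus>\<^bsub>R\<^esub> fst y, snd x \<ominus>\<^bsub>R\<^esub> snd y) | x y. x \<in> E \<and> y \<in> E}"

end

theory Submission
  imports Defs "HOL-Algebra.Multiplicative_Group" "HOL-Algebra.Subrings"
begin

text \<open>
  Take \<open>q = r\<^sup>3\<close> with \<open>r\<close> an even power of \<open>p\<close>, and let \<open>K\<close> be the subfield of order \<open>r\<close>.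
  For odd \<open>p\<close> there is an \<open>i\<close> with \<open>i\<^sup>2 = -1\<close>, and \<open>x\<^sup>2 + y\<^sup>2 = u v\<close> in the coordinates
  \<open>u = x + i y\<close>, \<open>v = x - i y\<close>. In these coordinates take \<open>E = U \<times> U\<close> where \<open>U = K + K t\<close> with
  \<open>t \<notin> K\<close>: then \<open>|E| = r\<^sup>4\<close>, and the distances are the products of two elements of \<open>U\<close>, that is,
  the values at \<open>t\<close> of the quadratic polynomials over \<open>K\<close> that split into linear factors. These
  make up about half of the \<open>r\<^sup>3\<close> polynomials of degree at most two. In characteristic two
  \<open>x\<^sup>2 + y\<^sup>2 = (x + y)\<^sup>2\<close>, and \<open>E = {(x, y). x + y \<in> K}\<close> has only \<open>r\<close> distances.
\<close>

section \<open>Binomial theorem, Frobenius map and characteristic\<close>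

lemma (in cring) binomial_finsum:
  assumes [simp]: "x \<in> carrier R" "y \<in> carrier R"
  shows "(x \<oplus> y) [^] (n::nat) = (\<Oplus>k\<in>{..n}. [(n choose k)] \<cdot> (x [^] k \<otimes> y [^] (n - k)))"
proof (induction n)
  case 0
  show ?case by simp
next
  case (Suc n)
  let ?f = "\<lambda>n k. x [^] k \<otimes> y [^] (n - k)"
  have x: "(\<Oplus>k\<in>{..n}. [(n choose k)] \<cdot> ?f n k) \<otimes> x = (\<Oplus>k\<in>{..n}. [(n choose k)] \<cdot> ?f (Suc n) (Suc k))"
    by (subst finsum_ldistr)
       (auto intro!: finsum_cong' simp: add_pow_ldistr add_pow_rdistr m_ac)
  have y: "(\<Oplus>k\<in>{..n}. [(n choose k)] \<cdot> ?f n k) \<otimes> y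
      = (\<Oplus>k\<in>{..n}. [(n choose Suc k)] \<cdot> ?f (Suc n) (Suc k)) \<oplus> ?f (Suc n) 0"
  proof -
    have "(\<Oplus>k\<in>{..n}. [(n choose k)] \<cdot> ?f n k) \<otimes> y = (\<Oplus>k\<in>{..n}. [(n choose k)] \<cdot> ?f (Suc n) k)"
      by (subst finsum_ldistr)
         (auto intro!: finsum_cong' simp: add_pow_ldistr m_assoc Suc_diff_le)
    \<comment> \<open>The added term has coefficient \<open>n choose Suc n = 0\<close>; with it,
      splitting off index 0 leaves a sum over \<open>{..n}\<close>, as in \<open>x\<close>.\<close>
    also have "\<dots> = (\<Oplus>k\<in>{..Suc n}. [(n choose k)] \<cdot> ?f (Suc n) k)"
      by (subst finsum_Suc) (auto simp: binomial_eq_0)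
    also have "\<dots> = (\<Oplus>k\<in>{..n}. [(n choose Suc k)] \<cdot> ?f (Suc n) (Suc k)) \<oplus> ?f (Suc n) 0"
      by (subst finsum_Suc2) auto
    finally show ?thesis .
  qed
  have "(x \<oplus> y) [^] Suc n = (\<Oplus>k\<in>{..n}. [(n choose k)] \<cdot> ?f n k) \<otimes> x \<oplus> (\<Oplus>k\<in>{..n}. [(n choose k)] \<cdot> ?f n k) \<otimes> y"
    by (simp add: Suc r_distr)
  also have "\<dots> = ((\<Oplus>k\<in>{..n}. [(n choose k)] \<cdot> ?f (Suc n) (Suc k))
      \<oplus> (\<Oplus>k\<in>{..n}. [(n choose Suc k)] \<cdot> ?f (Suc n) (Suc k))) \<oplus> ?f (Suc n) 0"
    unfolding x y by (subst a_assoc) auto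
  \<comment> \<open>Pascal's rule, termwise.\<close>
  also have "(\<Oplus>k\<in>{..n}. [(n choose k)] \<cdot> ?f (Suc n) (Suc k))
      \<oplus> (\<Oplus>k\<in>{..n}. [(n choose Suc k)] \<cdot> ?f (Suc n) (Suc k))
      = (\<Oplus>k\<in>{..n}. [(Suc n choose Suc k)] \<cdot> ?f (Suc n) (Suc k))"
    by (subst finsum_addf [symmetric]) (auto intro!: finsum_cong' simp: add.nat_pow_mult)
  also have "\<dots> \<oplus> ?f (Suc n) 0 = (\<Oplus>k\<in>{..Suc n}. [(Suc n choose k)] \<cdot> ?f (Suc n) k)"
    by (subst finsum_Suc2) auto
  finally show ?case .
qed

text \<open>The binomial coefficients strictly between the two ends are multiples of
  \<open>p\<close>, so only the end terms of the expansion survive.\<close>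

lemma (in cring) frobenius_add:
  assumes p: "Factorial_Ring.prime p" and char: "[p] \<cdot> \<one> = \<zero>"
    and [simp]: "x \<in> carrier R" "y \<in> carrier R"
  shows "(x \<oplus> y) [^] (p::nat) = x [^] p \<oplus> y [^] p"
proof -
  define g where "g k = [(p choose k)] \<cdot> (x [^] k \<otimes> y [^] (p - k))" for k
  have g: "g k \<in> carrier R" "g p = x [^] p" "g 0 = y [^] p" for k
    by (simp_all add: g_def)
  have mult: "[(p * m)] \<cdot> z = \<zero>" if "z \<in> carrier R" for z and m :: nat
  proof -
    have "[(p * m)] \<cdot> z = [m] \<cdot> ([p] \<cdot> (\<one> \<otimes> z))"
      using that by (simp add: add.nat_pow_pow)
    also have "\<dots> = \<zero>"
      using that by (simp add: add_pow_ldistr[symmetric] char del: l_one)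
    finally show ?thesis .
  qed
  \<comment> \<open>As a double successor, \<open>p\<close> allows both end terms to be split off;
    what remains is indexed by 1, ..., \<open>p - 1\<close>.\<close>
  obtain m where m: "p = Suc (Suc m)"
    using prime_ge_2_nat[OF p] by (metis add_2_eq_Suc nat_le_iff_add)
  have zero: "g k = \<zero>" if k: "0 < k" "k < p" for k
  proof -
    obtain l where "p choose k = p * l"
      using dvd_choose_prime[of k p] p k unfolding dvd_def by auto
    then show ?thesis by (simp add: g_def mult)
  qed
  have "(x \<oplus> y) [^] p = (\<Oplus>k\<in>{..Suc (Suc m)}. g k)"
    unfolding m[symmetric] g_def by (simp add: binomial_finsum)
  also have "\<dots> = g (Suc (Suc m)) \<oplus> (\<Oplus>k\<in>{..Suc m}. g k)"
    by (rule finsum_Suc) (simp add: g)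
  also have "(\<Oplus>k\<in>{..Suc m}. g k) = (\<Oplus>k\<in>{..m}. g (Suc k)) \<oplus> g 0"
    by (rule finsum_Suc2) (simp add: g)
  also have "(\<Oplus>k\<in>{..m}. g (Suc k)) = (\<Oplus>k\<in>{..m}. \<zero>)"
    by (rule finsum_cong') (auto simp: m intro!: zero)
  finally show ?thesis by (simp add: g flip: m)
qed

lemma (in cring) frobenius_pow_add:
  assumes "Factorial_Ring.prime p" "[p] \<cdot> \<one> = \<zero>" "x \<in> carrier R" "y \<in> carrier R"
  shows "(x \<oplus> y) [^] (p ^ k::nat) = x [^] (p ^ k) \<oplus> y [^] (p ^ k)"
proof (induction k)
  case 0
  then show ?case using assms by simp
next
  case (Suc k)
  have "(x \<oplus> y) [^] (p ^ Suc k) = ((x \<oplus> y) [^] (p ^ k)) [^] p"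
    using assms by (simp add: nat_pow_pow mult.commute)
  also have "\<dots> = x [^] (p ^ Suc k) \<oplus> y [^] (p ^ Suc k)"
    using assms unfolding Suc by (simp add: frobenius_add nat_pow_pow mult.commute)
  finally show ?case .
qed

lemma (in domain) nat_pow_nonzero:
  assumes "x \<in> carrier R" "x \<noteq> \<zero>"
  shows "x [^] (n::nat) \<noteq> \<zero>"
  using assms by (induction n) (auto simp: integral_iff)

text \<open>By Lagrange in the additive group, \<open>p ^ n\<close> times one is zero. This multiple
  is the \<open>n\<close>-th power of \<open>p\<close> times one, and a domain has no nonzero
  nilpotents.\<close>

lemma (in domain) prime_char_of_card:
  assumes p: "Factorial_Ring.prime p" and card: "card (carrier R) = p ^ n" and n: "n > 0"
  shows "[p] \<cdot> \<one> = \<zero>"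
proof -
  have "[card (carrier R)] \<cdot> \<one> = \<zero>"
    using add.pow_order_eq_1[of \<one>] by (simp add: order_def)
  moreover have "[(p ^ k)] \<cdot> \<one> = ([p] \<cdot> \<one>) [^] k" for k :: nat
  proof (induction k)
    case (Suc k)
    have "[(p ^ Suc k)] \<cdot> \<one> = [p] \<cdot> ([(p ^ k)] \<cdot> \<one> \<otimes> \<one>)"
      by (simp add: add.nat_pow_pow mult.commute)
    also have "\<dots> = [(p ^ k)] \<cdot> \<one> \<otimes> [p] \<cdot> \<one>"
      by (rule add_pow_rdistr[symmetric]) auto
    finally show ?case by (simp add: Suc)
  qed simp
  ultimately have "([p] \<cdot> \<one>) [^] n = \<zero>"
    by (simp add: card)
  then show ?thesis
    by (metis add.nat_pow_closed one_closed nat_pow_nonzero)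
qed

section \<open>Generators, square roots of -1 and subfields of finite fields\<close>

text \<open>The multiplicative group is cyclic. Stating this through powers in \<open>R\<close> and
  divisibility of exponents reduces later arguments to integer arithmetic.\<close>

lemma (in field) obtain_generator:
  assumes fin: "finite (carrier R)"
  obtains a where "a \<in> carrier R" "a \<noteq> \<zero>"
    "\<And>n::nat. a [^] n = \<one> \<longleftrightarrow> card (carrier R) - 1 dvd n"
    "\<And>x. x \<in> carrier R \<Longrightarrow> x \<noteq> \<zero> \<Longrightarrow> \<exists>n::nat. x = a [^] n"
proof -
  obtain a where a: "a \<in> carrier (mult_of R)"
    and gen: "carrier (mult_of R) = {a [^] i | i::nat. i \<in> UNIV}"
    using finite_field_mult_group_has_gen[OF fin] by blast
  interpret G: group "mult_of R" by (rule field_mult_group)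
  have finm: "finite (carrier (mult_of R))" using fin by (rule finite_mult_of)
  have "G.ord a = order (mult_of R)"
    using G.generate_pow_card[OF a] G.generate_pow_nat[OF a] G.ord_ge_1[OF finm a] gen
    by (auto simp: order_def nat_pow_mult_of)
  also have "\<dots> = card (carrier R) - 1"
    using order_mult_of[OF fin] by (simp add: order_def)
  finally show thesis
    using that[of a] a G.pow_eq_id[OF a] gen by (auto simp: nat_pow_mult_of)
qed

text \<open>A generator raised to a quarter of the group order has a square that squares to one but
  is not one, so this square is -1.\<close>

lemma (in field) obtain_sqrt_minus_one:
  assumes fin: "finite (carrier R)" and "4 dvd card (carrier R) - 1"
  obtains i where "i \<in> carrier R" "i \<otimes> i = \<ominus> \<one>"
proof -
  obtain a where a: "a \<in> carrier R"
    and pow: "\<And>n::nat. a [^] n = \<one> \<longleftrightarrow> card (carrier R) - 1 dvd n"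
    using obtain_generator[OF fin] by metis
  obtain m where m: "card (carrier R) - 1 = 4 * m" using assms(2) by (auto elim: dvdE)
  \<comment> \<open>At least two elements, so the group order \<open>4 * m\<close> is positive and
    does not divide \<open>2 * m\<close>.\<close>
  have "card {\<zero>, \<one>} \<le> card (carrier R)" using fin by (intro card_mono) auto
  then have m0: "m > 0" using m by (intro gr0I) auto
  define i where "i = a [^] m"
  have ii: "i \<otimes> i = a [^] (2 * m)" using a by (simp add: i_def nat_pow_mult mult_2)
  have sq: "(i \<otimes> i) \<otimes> (i \<otimes> i) = \<one>"
    unfolding ii using a pow[of "4 * m"] m by (simp add: nat_pow_mult)
  have ne: "i \<otimes> i \<noteq> \<one>" unfolding ii pow m using m0 by (auto dest: dvd_imp_le)
  have ic: "i \<in> carrier R" using a by (simp add: i_def)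
  show thesis
    using that[OF ic] square_eq_one[of "i \<otimes> i"] sq ne ic by auto
qed

text \<open>The subfield consists of the fixed points of the \<open>r\<close>-th power map, which is
  additive because \<open>r\<close> is a power of the characteristic. Its nonzero elements are the
  roots of unity of order dividing \<open>r - 1\<close>, counted with a generator.\<close>

lemma (in field) obtain_subfield:
  assumes p: "Factorial_Ring.prime p" and card: "card (carrier R) = (p ^ k) ^ m" and km: "k > 0" "m > 0"
  obtains K where "subfield K R" "card K = p ^ k"
proof -
  define r where "r = p ^ k"
  have r: "r \<ge> 2" unfolding r_def using prime_ge_2_nat[OF p] self_le_power[of p k] km by linarith
  have fin: "finite (carrier R)"
    using card p by (metis card.infinite not_prime_0 power_not_zero)
  have char: "[p] \<cdot> \<one> = \<zero>"
    by (rule prime_char_of_card[OF p, of "k * m"]) (use card km in \<open>auto simp: power_mult\<close>)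
  define K where "K = {x \<in> carrier R. x [^] r = x}"
  have add: "x \<oplus> y \<in> K" if "x \<in> K" "y \<in> K" for x y
    using that frobenius_pow_add[OF p char, of x y k] by (auto simp: K_def r_def)
  \<comment> \<open>Additivity of the power map applied to \<open>1 + (-1) = 0\<close> avoids a
    distinction by the parity of \<open>r\<close>.\<close>
  have neg1: "\<ominus> \<one> \<in> K"
  proof -
    have "\<zero> = (\<one> \<oplus> \<ominus> \<one>) [^] r" using r by (simp add: r_neg nat_pow_zero)
    also have "\<dots> = \<one> \<oplus> (\<ominus> \<one>) [^] r"
      using frobenius_pow_add[OF p char, of \<one> "\<ominus> \<one>" k] by (simp add: r_def)
    finally have "(\<ominus> \<one>) [^] r \<oplus> \<one> = \<zero>" by (simp add: a_comm)
    then have "\<ominus> \<one> = (\<ominus> \<one>) [^] r" by (rule minus_equality) simp_all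
    then show ?thesis unfolding K_def by auto
  qed
  have mult: "x \<otimes> y \<in> K" if "x \<in> K" "y \<in> K" for x y
    using that by (auto simp: K_def nat_pow_distrib)
  have sub: "subring K R"
  proof (rule subringI)
    show "\<ominus> h \<in> K" if "h \<in> K" for h
      using mult[OF neg1 that] that by (simp add: K_def l_minus)
  qed (use add mult in \<open>auto simp: K_def\<close>)
  have "subfield K R"
  proof (rule subfieldI'[OF sub])
    fix x assume x: "x \<in> K - {\<zero>}"
    then have u: "x \<in> Units R" and xc: "x \<in> carrier R" "x [^] r = x"
      by (auto simp: K_def field_Units)
    \<comment> \<open>Since \<open>x\<close> equals its \<open>r\<close>-th power, the
      \<open>r\<close>-th power of \<open>inv x\<close> is again an inverse of
      \<open>x\<close>.\<close>
    then have "x \<otimes> inv x [^] r = \<one>"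
      using nat_pow_distrib[of x "inv x" r] by simp
    then have "inv x [^] r = inv x"
      using u xc by (metis Units_inv_closed comm_inv_char nat_pow_closed)
    then show "inv x \<in> K"
      using u by (simp add: K_def)
  qed
  moreover have "card K = r"
  proof -
    obtain a where a: "a \<in> carrier R" "a \<noteq> \<zero>"
      and pow: "\<And>n::nat. a [^] n = \<one> \<longleftrightarrow> card (carrier R) - 1 dvd n"
      and gen: "\<And>x. x \<in> carrier R \<Longrightarrow> x \<noteq> \<zero> \<Longrightarrow> \<exists>n::nat. x = a [^] n"
      using obtain_generator[OF fin] by metis
    \<comment> \<open>The order of the group is thus a multiple \<open>(r - 1) * s\<close>, and the
      \<open>s\<close>-th power \<open>b\<close> of the generator has order exactly
      \<open>r - 1\<close>.\<close>
    have "r - 1 dvd r ^ m - 1"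
    proof (induction m)
      case (Suc m)
      have "r ^ Suc m - 1 = r * (r ^ m - 1) + (r - 1)"
        using r by (simp add: diff_mult_distrib2)
      then show ?case using Suc by simp
    qed simp
    then obtain s where s: "card (carrier R) - 1 = (r - 1) * s"
      using card by (auto simp: r_def elim: dvdE)
    have "card (carrier R) > 1"
      using card r km one_less_power[of r m] by (simp flip: r_def)
    then have s0: "s > 0" using s by (intro gr0I) auto
    define b where "b = a [^] s"
    have b: "b \<in> carrier R" "b \<noteq> \<zero>"
      using a nat_pow_nonzero[of a s] by (auto simp: b_def)
    have bpow: "b [^] n = \<one> \<longleftrightarrow> r - 1 dvd n" for n :: nat
      unfolding b_def nat_pow_pow[OF a(1)] pow s using s0 by (simp add: mult.commute)
    have frob: "x [^] r = x \<longleftrightarrow> x [^] (r - 1) = \<one>" if "x \<in> carrier R" "x \<noteq> \<zero>" for x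
    proof -
      have "x [^] r = x [^] (r - 1) \<otimes> x"
        using r that(1) by (metis Suc_diff_1 nat_pow_Suc less_le_trans pos2)
      then show ?thesis
        using that by (metis l_one m_rcancel nat_pow_closed one_closed)
    qed
    have "K - {\<zero>} = (\<lambda>n. b [^] n) ` {..<r - 1}"
    proof (intro equalityI subsetI)
      fix x assume "x \<in> K - {\<zero>}"
      then have x: "x \<in> carrier R" "x \<noteq> \<zero>" "x [^] (r - 1) = \<one>"
        using frob by (auto simp: K_def)
      obtain j where j: "x = a [^] (j::nat)" using gen x by blast
      \<comment> \<open>Cancelling \<open>r - 1\<close> makes \<open>j\<close> a multiple of
        \<open>s\<close>, so \<open>x\<close> is a power of \<open>b\<close>; its exponent is then
        reduced modulo \<open>r - 1\<close>.\<close>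
      have "(r - 1) * s dvd j * (r - 1)"
        using x(3) unfolding j nat_pow_pow[OF a(1)] pow s .
      then have "s dvd j" using r by (simp add: mult.commute)
      then obtain l where l: "j = s * l" by (auto elim: dvdE)
      have "x = b [^] l" using a(1) by (simp add: j l b_def nat_pow_pow)
      also have "\<dots> = b [^] ((r - 1) * (l div (r - 1)) + l mod (r - 1))" by simp
      also have "\<dots> = b [^] ((r - 1) * (l div (r - 1))) \<otimes> b [^] (l mod (r - 1))"
        using b(1) by (rule nat_pow_mult[symmetric])
      also have "\<dots> = b [^] (l mod (r - 1))"
        using bpow[of "(r - 1) * (l div (r - 1))"] b by simp
      finally show "x \<in> (\<lambda>n. b [^] n) ` {..<r - 1}" using r by auto
    next
      fix x assume "x \<in> (\<lambda>n. b [^] n) ` {..<r - 1}"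
      then obtain n where x: "x = b [^] (n::nat)" by auto
      have "x [^] (r - 1) = \<one>"
        using b bpow[of "n * (r - 1)"] by (simp add: x nat_pow_pow)
      moreover have "x \<in> carrier R" "x \<noteq> \<zero>" using b nat_pow_nonzero[of b n] by (auto simp: x)
      ultimately show "x \<in> K - {\<zero>}" using frob by (auto simp: K_def)
    qed
    moreover have "inj_on (\<lambda>n. b [^] n) {..<r - 1}"
    proof (rule linorder_inj_onI)
      fix i j assume ij: "i < j" "i \<in> {..<r - 1}" "j \<in> {..<r - 1}"
      show "b [^] i \<noteq> b [^] j"
      proof
        assume eq: "b [^] i = b [^] j"
        have "b [^] i \<otimes> b [^] (j - i) = b [^] j"
          using ij b by (simp add: nat_pow_mult)
        also have "\<dots> = b [^] i \<otimes> \<one>" using b eq by simp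
        finally have "b [^] i \<otimes> b [^] (j - i) = b [^] i \<otimes> \<one>" .
        then have "b [^] (j - i) = \<one>"
          using b nat_pow_nonzero[of b i] by (subst (asm) m_lcancel) auto
        then have "r - 1 dvd j - i" by (simp add: bpow)
        then show False using ij by (auto dest: dvd_imp_le)
      qed
    qed auto
    ultimately have "card (K - {\<zero>}) = r - 1" by (simp add: card_image)
    moreover have "\<zero> \<in> K" using r by (simp add: K_def nat_pow_zero)
    moreover have "finite K" using fin by (simp add: K_def)
    ultimately show ?thesis using r by (simp add: card_Diff_singleton)
  qed
  ultimately show thesis using that by (simp add: r_def)
qed

section \<open>Counting products of two elements of \<open>K + K t\<close>\<close>

text \<open>A symmetric function depends only on the unordered pair, and there are
  \<open>n (n + 1) / 2\<close> of these, repetitions included. In the induction, a new element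
  \<open>a\<close> contributes only the values \<open>f a w\<close>.\<close>

lemma card_symmetric_image_le:
  assumes "finite A" and sym: "\<And>x y. x \<in> A \<Longrightarrow> y \<in> A \<Longrightarrow> f x y = f y x"
  shows "2 * card ((\<lambda>(x, y). f x y) ` (A \<times> A)) \<le> card A * (card A + 1)"
  using assms
proof (induction A rule: finite_induct)
  case empty
  then show ?case by simp
next
  case (insert a A)
  let ?F = "\<lambda>A. (\<lambda>(x, y). f x y) ` (A \<times> A)"
  have "?F (insert a A) = ?F A \<union> f a ` insert a A"
  proof (intro equalityI subsetI)
    fix z assume "z \<in> ?F (insert a A)"
    then obtain x y where z: "z = f x y" and xy: "x \<in> insert a A" "y \<in> insert a A" by auto
    show "z \<in> ?F A \<union> f a ` insert a A"
    proof (cases "x \<in> A \<and> y \<in> A")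
      case False
      then obtain w where "w \<in> insert a A" "z = f a w"
        using xy insert.prems[OF xy] z by (metis insert_iff)
      then have "z \<in> f a ` insert a A" by blast
      then show ?thesis ..
    qed (use z in auto)
  qed auto
  then have "card (?F (insert a A)) \<le> card (?F A) + card (f a ` insert a A)"
    by (simp only: card_Un_le)
  also have "card (f a ` insert a A) \<le> card A + 1"
    using card_image_le[of "insert a A" "f a"] insert.hyps by simp
  finally have "2 * card (?F (insert a A)) \<le> 2 * card (?F A) + 2 * (card A + 1)" by simp
  also have "2 * card (?F A) \<le> card A * (card A + 1)"
    using insert by blast
  finally show ?case using insert.hyps by (simp add: algebra_simps)
qed

definition (in ring) span_one :: "'a set \<Rightarrow> 'a \<Rightarrow> 'a set" where
  "span_one K t = (\<lambda>(a, b). a \<oplus> b \<otimes> t) ` (K \<times> K)"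

lemma (in ring) span_one_minus:
  assumes "subring K R" "t \<in> carrier R" "u \<in> span_one K t" "v \<in> span_one K t"
  shows "u \<ominus> v \<in> span_one K t"
proof -
  note sub = subringE[OF assms(1)]
  obtain a b c d where ab: "a \<in> K" "b \<in> K" "c \<in> K" "d \<in> K"
    and u: "u = a \<oplus> b \<otimes> t" and v: "v = c \<oplus> d \<otimes> t"
    using assms(3,4) by (auto simp: span_one_def)
  have cs [simp]: "a \<in> carrier R" "b \<in> carrier R" "c \<in> carrier R" "d \<in> carrier R"
    using ab sub(1) by auto
  have "u \<ominus> v = (a \<ominus> c) \<oplus> (b \<ominus> d) \<otimes> t"
    using assms(2) cs unfolding u v by algebra
  moreover have "a \<ominus> c \<in> K" "b \<ominus> d \<in> K"
    using ab sub(5,7) by (auto simp: a_minus_def)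
  ultimately show ?thesis by (auto simp: span_one_def)
qed

text \<open>One and \<open>t\<close> are linearly independent over \<open>K\<close>, so each element
  has a unique pair of coefficients.\<close>

lemma (in field) card_span_one:
  assumes K: "subfield K R" and t: "t \<in> carrier R" "t \<notin> K"
  shows "card (span_one K t) = card K ^ 2"
proof -
  note sub = subringE[OF subfieldE(1)[OF K]]
  have "inj_on (\<lambda>(a, b). a \<oplus> b \<otimes> t) (K \<times> K)"
  proof (rule inj_onI, clarify)
    fix a b c d assume ab: "a \<in> K" "b \<in> K" "c \<in> K" "d \<in> K"
      and eq: "a \<oplus> b \<otimes> t = c \<oplus> d \<otimes> t"
    have cs [simp]: "a \<in> carrier R" "b \<in> carrier R" "c \<in> carrier R" "d \<in> carrier R" "t \<in> carrier R"
      using ab sub(1) t by auto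
    have "(b \<ominus> d) \<otimes> t = (a \<oplus> b \<otimes> t) \<ominus> d \<otimes> t \<ominus> a" using cs by algebra
    also have "\<dots> = c \<ominus> a" unfolding eq using cs by algebra
    finally have bd: "(b \<ominus> d) \<otimes> t = c \<ominus> a" .
    have mem: "b \<ominus> d \<in> K" "c \<ominus> a \<in> K" using ab sub(5,7) by (auto simp: a_minus_def)
    \<comment> \<open>Otherwise division by \<open>b - d\<close> would put \<open>t\<close> into
      \<open>K\<close>.\<close>
    have "b \<ominus> d = \<zero>"
      using subfield_m_inv_simprule[OF K, of "b \<ominus> d" t] mem bd t by auto
    then have "b = d" by simp
    then show "a = c \<and> b = d" using eq by simp
  qed
  then show ?thesis
    by (simp add: span_one_def card_image card_cartesian_product power2_eq_square)
qed

text \<open>After scaling, a product of two elements of \<open>K + K t\<close> is either of the form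
  \<open>l (1 + c t) (1 + d t)\<close>, which is symmetric in \<open>c\<close> and \<open>d\<close> and hence takes about half as many
  values as there are triples, or a combination of \<open>t\<close> and \<open>t\<^sup>2\<close>.\<close>

lemma (in field) card_span_one_products_le:
  assumes K: "subfield K R" and fin: "finite K" and t: "t \<in> carrier R"
  defines "U \<equiv> span_one K t"
  shows "2 * card {u \<otimes> v | u v. u \<in> U \<and> v \<in> U} \<le> card K ^ 3 + 3 * card K ^ 2"
proof -
  note sub = subringE[OF subfieldE(1)[OF K]]
  have Kc: "x \<in> K \<Longrightarrow> x \<in> carrier R" for x using sub(1) by auto
  define g where "g c d = (\<one> \<oplus> c \<otimes> t) \<otimes> (\<one> \<oplus> d \<otimes> t)" for c d
  define G where "G = (\<lambda>(c, d). g c d) ` (K \<times> K)"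
  define A where "A = (\<lambda>(l, z). l \<otimes> z) ` (K \<times> G)"
  define B where "B = (\<lambda>(e, f). e \<otimes> t \<oplus> f \<otimes> (t \<otimes> t)) ` (K \<times> K)"
  \<comment> \<open>A factor with zero constant coefficient removes the constant term of the
    product.\<close>
  have prod_B: "(\<zero> \<oplus> b \<otimes> t) \<otimes> (c \<oplus> d \<otimes> t) \<in> B" if bcd: "b \<in> K" "c \<in> K" "d \<in> K" for b c d
  proof -
    have cs [simp]: "b \<in> carrier R" "c \<in> carrier R" "d \<in> carrier R" using that Kc by auto
    have "(\<zero> \<oplus> b \<otimes> t) \<otimes> (c \<oplus> d \<otimes> t) = (b \<otimes> c) \<otimes> t \<oplus> (b \<otimes> d) \<otimes> (t \<otimes> t)"
      using t cs by algebra
    then show ?thesis using that sub(6) by (auto simp: B_def)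
  qed
  have "u \<otimes> v \<in> A \<union> B" if uv: "u \<in> U" "v \<in> U" for u v
  proof -
    obtain a b c d where ab: "a \<in> K" "b \<in> K" "c \<in> K" "d \<in> K"
      and u: "u = a \<oplus> b \<otimes> t" and v: "v = c \<oplus> d \<otimes> t"
      using uv by (auto simp: U_def span_one_def)
    have cs [simp]: "a \<in> carrier R" "b \<in> carrier R" "c \<in> carrier R" "d \<in> carrier R" "t \<in> carrier R"
      using ab Kc t by auto
    consider "a = \<zero>" | "c = \<zero>" | "a \<noteq> \<zero>" "c \<noteq> \<zero>" by blast
    then show ?thesis
    proof cases
      case 1
      then show ?thesis using prod_B[of b c d] ab by (simp add: u v)
    next
      case 2
      have "u \<otimes> v = v \<otimes> u" unfolding u v by (rule m_comm) auto
      then show ?thesis using 2 prod_B[of d a b] ab by (simp add: u v)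
    next
      case 3
      \<comment> \<open>Both constant coefficients are invertible here; pulling them out normalises
        the factors to constant term one.\<close>
      have factor: "x \<oplus> y \<otimes> t = x \<otimes> (\<one> \<oplus> (y \<otimes> inv x) \<otimes> t)"
        if "x \<in> K" "x \<noteq> \<zero>" "y \<in> K" for x y
      proof -
        have c: "x \<in> carrier R" "inv x \<in> carrier R" "y \<in> carrier R"
          using that Kc subfield_m_inv(1)[OF K, of x] by auto
        have "x \<otimes> (\<one> \<oplus> (y \<otimes> inv x) \<otimes> t) = x \<oplus> (x \<otimes> inv x) \<otimes> (y \<otimes> t)"
          using c t by algebra
        then show ?thesis using c t that subfield_m_inv(2)[OF K, of x] by simp
      qed
      have inv: "inv a \<in> K" "inv c \<in> K"
        using 3 ab subfield_m_inv(1)[OF K] by auto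
      then have cs [simp]: "inv a \<in> carrier R" "inv c \<in> carrier R" using Kc by auto
      have "u \<otimes> v = (a \<otimes> c) \<otimes> g (b \<otimes> inv a) (d \<otimes> inv c)"
        unfolding u v g_def using 3 ab by (simp add: factor m_ac)
      moreover have "a \<otimes> c \<in> K" "b \<otimes> inv a \<in> K" "d \<otimes> inv c \<in> K"
        using ab inv sub(6) by auto
      ultimately show ?thesis by (auto simp: A_def G_def)
    qed
  qed
  then have subset: "{u \<otimes> v | u v. u \<in> U \<and> v \<in> U} \<subseteq> A \<union> B" by auto
  have finG: "finite G" and finAB: "finite A" "finite B"
    using fin by (auto simp: A_def B_def G_def)
  have "card {u \<otimes> v | u v. u \<in> U \<and> v \<in> U} \<le> card (A \<union> B)"
    using subset finAB by (intro card_mono) auto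
  also have "\<dots> \<le> card A + card B" by (rule card_Un_le)
  finally have "2 * card {u \<otimes> v | u v. u \<in> U \<and> v \<in> U} \<le> 2 * card A + 2 * card B" by simp
  moreover have "card B \<le> card K ^ 2"
    unfolding B_def using card_image_le[of "K \<times> K"] fin
    by (metis card_cartesian_product finite_cartesian_product power2_eq_square)
  moreover have "card A \<le> card K * card G"
    unfolding A_def using card_image_le[of "K \<times> G"] fin finG
    by (metis card_cartesian_product finite_cartesian_product)
  \<comment> \<open>Symmetry of \<open>g\<close> saves the factor two. With
    \<open>r = card K\<close>, this gives \<open>r^3 + r^2\<close> for twice the size of
    \<open>A\<close>, and \<open>B\<close> adds at most \<open>2 r^2\<close>.\<close>
  moreover have "2 * card G \<le> card K * (card K + 1)"
    unfolding G_def g_def using t Kc by (intro card_symmetric_image_le fin m_comm) auto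
  then have "card K * (2 * card G) \<le> card K * (card K * (card K + 1))"
    by (rule mult_le_mono2)
  ultimately show ?thesis
    by (simp add: power2_eq_square power3_eq_cube algebra_simps)
qed

section \<open>Point sets with few distances\<close>

text \<open>The coordinate change \<open>h\<close> is a linear bijection of the plane, so the
  preimage of \<open>U \<times> U\<close> has \<open>card U ^ 2\<close> points. As \<open>U\<close>
  is closed under differences, every distance is a product of two elements of
  \<open>U\<close>.\<close>

lemma (in field) distance_set_span_one:
  assumes fin: "finite (carrier R)" and two: "\<one> \<oplus> \<one> \<noteq> \<zero>"
    and i: "i \<in> carrier R" "i \<otimes> i = \<ominus> \<one>"
    and K: "subfield K R" and t: "t \<in> carrier R" "t \<notin> K"
  shows "\<exists>E \<subseteq> plane R. card E = card K ^ 4 \<and>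
    2 * card (distance_set R E) \<le> card K ^ 3 + 3 * card K ^ 2"
proof -
  note sub = subringE[OF subfieldE(1)[OF K]]
  define U where "U = span_one K t"
  have Uc: "U \<subseteq> carrier R"
    using sub(1) t by (auto simp: U_def span_one_def)
  define h where "h = (\<lambda>(x, y). (x \<oplus> i \<otimes> y, x \<ominus> i \<otimes> y))"
  define E where "E = {z \<in> plane R. h z \<in> U \<times> U}"
  have inj: "inj_on h (plane R)"
  proof (rule inj_onI)
    fix z w assume "z \<in> plane R" "w \<in> plane R" and eq: "h z = h w"
    then obtain x y x' y' where zw: "z = (x, y)" "w = (x', y')"
      and cs [simp]: "x \<in> carrier R" "y \<in> carrier R" "x' \<in> carrier R" "y' \<in> carrier R"
      by (auto simp: plane_def)
    note [simp] = i(1)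
    have e1: "x \<oplus> i \<otimes> y = x' \<oplus> i \<otimes> y'" and e2: "x \<ominus> i \<otimes> y = x' \<ominus> i \<otimes> y'"
      using eq by (auto simp: zw h_def)
    \<comment> \<open>The sum of the two coordinates is \<open>2 x\<close>, and 2 is invertible;
      \<open>y\<close> is then recovered since \<open>i\<close> is nonzero.\<close>
    have "(\<one> \<oplus> \<one>) \<otimes> x = (x \<oplus> i \<otimes> y) \<oplus> (x \<ominus> i \<otimes> y)" using cs i(1) by algebra
    also have "\<dots> = (\<one> \<oplus> \<one>) \<otimes> x'" unfolding e1 e2 using cs i(1) by algebra
    finally have x: "x = x'" using two by (simp add: m_lcancel)
    have "i \<noteq> \<zero>"
    proof
      assume "i = \<zero>"
      then have "\<ominus> \<one> = \<zero>" using i(2) by simp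
      then show False using r_neg[of \<one>] by simp
    qed
    moreover have "i \<otimes> y = i \<otimes> y'" using e1 x by simp
    ultimately show "z = w" using x by (simp add: zw m_lcancel)
  qed
  have "h ` plane R \<subseteq> plane R" using i by (auto simp: h_def plane_def)
  moreover have "finite (plane R)" using fin by (simp add: plane_def)
  \<comment> \<open>An injective self-map of a finite set is onto.\<close>
  ultimately have surj: "h ` plane R = plane R" using inj by (simp add: endo_inj_surj)
  have "h ` E = U \<times> U"
  proof (intro equalityI subsetI)
    fix w assume w: "w \<in> U \<times> U"
    then have "w \<in> h ` plane R" using surj Uc by (auto simp: plane_def)
    then obtain z where z: "z \<in> plane R" "w = h z" by (rule imageE)
    then have "z \<in> E" using w by (simp add: E_def)
    then show "w \<in> h ` E" unfolding z(2) by (rule imageI)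
  qed (auto simp: E_def)
  then have "card (U \<times> U) = card E"
    using inj by (metis (no_types, lifting) E_def card_image inj_on_subset mem_Collect_eq subsetI)
  then have "card E = card U * card U" by (simp add: card_cartesian_product)
  also have "\<dots> = card K ^ 4"
    unfolding U_def card_span_one[OF K t] by (simp flip: power_add)
  finally have cardE: "card E = card K ^ 4" .
  have "distance_set R E \<subseteq> {u \<otimes> v | u v. u \<in> U \<and> v \<in> U}"
  proof
    fix d assume "d \<in> distance_set R E"
    then obtain z w where z: "z \<in> E" "w \<in> E"
      and d: "d = sq_norm R (fst z \<ominus> fst w, snd z \<ominus> snd w)"
      by (auto simp: distance_set_def)
    obtain x y x' y' where zw: "z = (x, y)" "w = (x', y')" by (cases z, cases w)
    have cs [simp]: "x \<in> carrier R" "y \<in> carrier R" "x' \<in> carrier R" "y' \<in> carrier R" "i \<in> carrier R"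
      using z i by (auto simp: zw E_def plane_def)
    define X Y where "X = x \<ominus> x'" and "Y = y \<ominus> y'"
    have XY [simp]: "X \<in> carrier R" "Y \<in> carrier R" by (auto simp: X_def Y_def)
    \<comment> \<open>By linearity, the new coordinates of the difference vector are differences of
      elements of \<open>U\<close>.\<close>
    have "X \<oplus> i \<otimes> Y = (x \<oplus> i \<otimes> y) \<ominus> (x' \<oplus> i \<otimes> y')"
      "X \<ominus> i \<otimes> Y = (x \<ominus> i \<otimes> y) \<ominus> (x' \<ominus> i \<otimes> y')"
      unfolding X_def Y_def using cs by algebra+
    then have "X \<oplus> i \<otimes> Y \<in> U" "X \<ominus> i \<otimes> Y \<in> U"
      using z span_one_minus[OF subfieldE(1)[OF K] t(1)] by (auto simp: zw E_def h_def U_def)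
    moreover have "d = (X \<oplus> i \<otimes> Y) \<otimes> (X \<ominus> i \<otimes> Y)"
    proof -
      have "(X \<oplus> i \<otimes> Y) \<otimes> (X \<ominus> i \<otimes> Y) = X \<otimes> X \<ominus> (i \<otimes> i) \<otimes> (Y \<otimes> Y)" using XY cs by algebra
      also have "\<dots> = X \<otimes> X \<oplus> Y \<otimes> Y" unfolding i(2) using XY by algebra
      finally show ?thesis
        by (simp add: d zw sq_norm_def numeral_2_eq_2 flip: X_def Y_def)
    qed
    ultimately show "d \<in> {u \<otimes> v | u v. u \<in> U \<and> v \<in> U}" by blast
  qed
  moreover have "{u \<otimes> v | u v. u \<in> U \<and> v \<in> U} \<subseteq> carrier R" using Uc by auto
  ultimately have "card (distance_set R E) \<le> card {u \<otimes> v | u v. u \<in> U \<and> v \<in> U}"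
    using fin by (meson card_mono finite_subset)
  moreover have "2 * card {u \<otimes> v | u v. u \<in> U \<and> v \<in> U} \<le> card K ^ 3 + 3 * card K ^ 2"
    unfolding U_def by (rule card_span_one_products_le[OF K finite_subset[OF sub(1) fin] t(1)])
  ultimately have "2 * card (distance_set R E) \<le> card K ^ 3 + 3 * card K ^ 2" by linarith
  moreover have "E \<subseteq> plane R" by (simp add: E_def)
  ultimately show ?thesis using cardE by blast
qed

text \<open>The norm is the square of the coordinate sum, so a distance depends only on the sums of
  the two points. The set \<open>E\<close> is the union of the lines on which this sum is a fixed
  \<open>s\<close> in \<open>K\<close>.\<close>

lemma (in field) distance_set_char_two:
  assumes fin: "finite (carrier R)" and two: "\<one> \<oplus> \<one> = \<zero>" and K: "subfield K R"
  shows "\<exists>E \<subseteq> plane R. card E = card (carrier R) * card K \<and> card (distance_set R E) \<le> card K"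
proof -
  note sub = subringE[OF subfieldE(1)[OF K]]
  define E where "E = (\<lambda>(x, s). (x, s \<ominus> x)) ` (carrier R \<times> K)"
  have "inj_on (\<lambda>(x, s). (x, s \<ominus> x)) (carrier R \<times> K)"
    using sub(1) by (auto simp: inj_on_def a_minus_def subset_iff)
  then have "card E = card (carrier R) * card K"
    by (simp add: E_def card_image card_cartesian_product)
  moreover have "E \<subseteq> plane R" using sub(1) by (auto simp: E_def plane_def)
  moreover have "distance_set R E \<subseteq> (\<lambda>s. s \<otimes> s) ` K"
  proof
    fix d assume "d \<in> distance_set R E"
    then obtain x s x' s' where cs [simp]: "x \<in> carrier R" "x' \<in> carrier R" and s: "s \<in> K" "s' \<in> K"
      and d: "d = sq_norm R (x \<ominus> x', (s \<ominus> x) \<ominus> (s' \<ominus> x'))"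
      by (fastforce simp: distance_set_def E_def)
    have ss [simp]: "s \<in> carrier R" "s' \<in> carrier R" using s sub(1) by auto
    define X S where "X = x \<ominus> x'" and "S = s \<ominus> s'"
    have XY [simp]: "X \<in> carrier R" "S \<in> carrier R" by (auto simp: X_def S_def)
    have "(s \<ominus> x) \<ominus> (s' \<ominus> x') = S \<ominus> X" unfolding X_def S_def using cs ss by algebra
    then have "d = X \<otimes> X \<oplus> (S \<ominus> X) \<otimes> (S \<ominus> X)"
      by (simp add: d sq_norm_def numeral_2_eq_2 flip: X_def)
    \<comment> \<open>Terms are grouped to isolate the factor 2, which is zero.\<close>
    also have "\<dots> = S \<otimes> S \<oplus> (\<one> \<oplus> \<one>) \<otimes> (X \<otimes> X \<ominus> S \<otimes> X)" using XY by algebra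
    also have "\<dots> = S \<otimes> S" by (simp add: two)
    finally have "d = S \<otimes> S" .
    moreover have "S \<in> K" using s sub(5,7) by (auto simp: S_def a_minus_def)
    ultimately show "d \<in> (\<lambda>s. s \<otimes> s) ` K" by blast
  qed
  then have "card (distance_set R E) \<le> card K"
    using finite_subset[OF sub(1) fin] by (rule surj_card_le[rotated])
  ultimately show ?thesis by blast
qed

text \<open>The cube gives a subfield of order \<open>r\<close> in a field of order
  \<open>r^3\<close>; the even exponent makes \<open>r^3\<close> a square, which for odd
  \<open>p\<close> provides a square root of -1. The split is on whether 2 vanishes in the
  field.\<close>

lemma (in field) small_distance_set:
  assumes p: "Factorial_Ring.prime p" and k: "k > 0" and r: "r = p ^ (2 * k)"
    and card: "card (carrier R) = r ^ 3"
  shows "\<exists>E \<subseteq> plane R. card E = r ^ 4 \<and> 2 * card (distance_set R E) \<le> r ^ 3 + 3 * r ^ 2"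
proof -
  have r4: "r \<ge> 4"
  proof -
    have "p ^ 2 \<le> p ^ (2 * k)" using k prime_gt_0_nat[OF p] by (intro power_increasing) auto
    moreover have "2 ^ 2 \<le> p ^ 2" using prime_ge_2_nat[OF p] by (intro power_mono) auto
    ultimately show ?thesis by (simp add: r)
  qed
  have fin: "finite (carrier R)" using card r4 by (intro card_ge_0_finite) simp
  obtain K where K: "subfield K R" and cardK: "card K = r"
    using obtain_subfield[OF p, of "2 * k" 3] card k unfolding r by auto
  show ?thesis
  proof (cases "\<one> \<oplus> \<one> = \<zero>")
    case True
    obtain E where "E \<subseteq> plane R" "card E = r ^ 4" "card (distance_set R E) \<le> r"
      using distance_set_char_two[OF fin True K] unfolding card cardK
      by (auto simp flip: power_Suc2)
    moreover have "2 * r \<le> r ^ 3 + 3 * r ^ 2"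
      using r4 self_le_power[of r 2] by simp
    ultimately show ?thesis by (intro exI[of _ E]) linarith
  next
    case False
    have "odd p"
    proof (rule ccontr)
      assume "\<not> odd p"
      then have "p = 2" using p primes_dvd_imp_eq two_is_prime_nat by blast
      then have "[(2::nat)] \<cdot> \<one> = \<zero>"
        using prime_char_of_card[OF p, of "2 * k * 3"] card k unfolding r power_mult[symmetric]
        by simp
      then show False using False by (simp add: numeral_2_eq_2)
    qed
    have "4 dvd card (carrier R) - 1"
    proof -
      \<comment> \<open>The field has \<open>m^2\<close> elements, and an odd square is 1 modulo
        4.\<close>
      define m where "m = p ^ (k * 3)"
      have "odd m" using \<open>odd p\<close> by (simp add: m_def)
      then obtain l where "m = 2 * l + 1" by (rule oddE)
      then have "m ^ 2 - 1 = 4 * (l * l + l)" by (simp add: power2_eq_square algebra_simps)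
      moreover have "card (carrier R) = m ^ 2"
        unfolding card r m_def power_mult[symmetric] by (simp add: ac_simps)
      ultimately show ?thesis by simp
    qed
    then obtain i where i: "i \<in> carrier R" "i \<otimes> i = \<ominus> \<one>"
      using obtain_sqrt_minus_one[OF fin] by blast
    have "card K < card (carrier R)"
      unfolding card cardK using r4 power_strict_increasing[of 1 3 r] by simp
    moreover have "K \<subseteq> carrier R" by (rule subfieldE(3)[OF K])
    ultimately have "K \<subset> carrier R" by auto
    then obtain t where t: "t \<in> carrier R" "t \<notin> K" by (rule psubset_imp_ex_mem[THEN exE]) auto
    show ?thesis using distance_set_span_one[OF fin False i K t] unfolding cardK .
  qed
qed

section \<open>Limit superior along a set, and the choice of the prime powers\<close>

text \<open>The filter expresses that \<open>q\<close> tends to infinity inside \<open>Q\<close>. It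
  is nontrivial because \<open>Q\<close> is infinite, so the limit of \<open>g\<close> is also its
  limit superior, which dominates that of \<open>f\<close>.\<close>

lemma Limsup_principal_le_of_tendsto:
  fixes f g :: "nat \<Rightarrow> real"
  assumes "infinite Q" and le: "\<And>q. q \<in> Q \<Longrightarrow> f q \<le> g q" and lim: "(g \<longlongrightarrow> c) at_top"
  shows "Limsup (inf at_top (principal Q)) (\<lambda>q. ereal (f q)) \<le> ereal c"
proof -
  let ?F = "inf at_top (principal Q)"
  have ne: "?F \<noteq> bot"
    using assms(1) by (auto simp: trivial_limit_def eventually_inf_principal eventually_sequentially
        infinite_nat_iff_unbounded_le)
  have "((\<lambda>q. ereal (g q)) \<longlongrightarrow> ereal c) ?F"
    using lim by (intro tendsto_intros tendsto_mono[OF inf_le1])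
  then have "Limsup ?F (\<lambda>q. ereal (g q)) = ereal c"
    using ne by (rule lim_imp_Limsup[rotated])
  moreover have "Limsup ?F (\<lambda>q. ereal (f q)) \<le> Limsup ?F (\<lambda>q. ereal (g q))"
    by (rule Limsup_mono) (simp add: eventually_inf_principal le)
  ultimately show ?thesis by simp
qed

theorem theorem2:
  fixes p :: nat and F :: "nat \<Rightarrow> ('a, 'm) ring_scheme"
  assumes "Factorial_Ring.prime p"
    and "\<And>n. 0 < n \<Longrightarrow> field (F (p ^ n)) \<and> card (carrier (F (p ^ n))) = p ^ n"
  shows "\<exists>(Q :: nat set) (E :: nat \<Rightarrow> ('a \<times> 'a) set).
    infinite Q \<and> Q \<subseteq> {p ^ n | n. 0 < n} \<and>
    (\<forall>q\<in>Q. E q \<subseteq> plane (F q) \<and>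
       real (card (E q)) = real q powr (4 / 3) \<and>
       distance_set (F q) (E q) \<noteq> carrier (F q)) \<and>
    Limsup (inf at_top (principal Q))
      (\<lambda>q. ereal (real (card (distance_set (F q) (E q))) / real q)) \<le> ereal (1 / 2)"
proof -
  have p2: "p \<ge> 2" using assms(1) by (rule prime_ge_2_nat)
  \<comment> \<open>The exponent \<open>6 * k\<close> makes \<open>q\<close> the cube of
    \<open>r = p ^ (2 * k)\<close>, itself an even power of \<open>p\<close>; \<open>k > 0\<close>
    excludes \<open>q = 1\<close>.\<close>
  define Q where "Q = (\<lambda>k. p ^ (6 * k)) ` {0<..}"
  have "inj_on (\<lambda>k. p ^ (6 * k)) {0<..}"
    using p2 by (auto simp: inj_on_def power_inject_exp)
  then have inf: "infinite Q"
    unfolding Q_def by (simp add: finite_image_iff infinite_Ioi)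
  have Qsub: "Q \<subseteq> {p ^ n | n. 0 < n}" by (force simp: Q_def)
  \<comment> \<open>The root \<open>r\<close> is kept alongside \<open>E\<close> so that both can be
    chosen as functions of \<open>q\<close>; \<open>r \<ge> 4\<close> later yields
    \<open>3 r^2 < r^3\<close>.\<close>
  have ex: "\<forall>q\<in>Q. \<exists>E r. E \<subseteq> plane (F q) \<and> r \<ge> 4 \<and> q = r ^ 3 \<and> card (carrier (F q)) = q \<and>
      card E = r ^ 4 \<and> 2 * card (distance_set (F q) E) \<le> r ^ 3 + 3 * r ^ 2"
  proof
    fix q assume qQ: "q \<in> Q"
    obtain k where k: "k > 0" "q = p ^ (6 * k)" using qQ by (auto simp: Q_def)
    define r where "r = p ^ (2 * k)"
    have q: "q = r ^ 3" by (simp add: k r_def flip: power_mult)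
    have F: "field (F q)" "card (carrier (F q)) = q" using assms(2)[of "6 * k"] k by auto
    obtain E where "E \<subseteq> plane (F q)" "card E = r ^ 4"
      "2 * card (distance_set (F q) E) \<le> r ^ 3 + 3 * r ^ 2"
      using field.small_distance_set[OF F(1) assms(1) k(1) r_def] F(2) q by auto
    moreover have "r \<ge> 4"
    proof -
      have "2 ^ 2 \<le> p ^ 2" using p2 by (intro power_mono) auto
      also have "p ^ 2 \<le> r" unfolding r_def using k p2 by (intro power_increasing) auto
      finally show ?thesis by simp
    qed
    ultimately show "\<exists>E r. E \<subseteq> plane (F q) \<and> r \<ge> 4 \<and> q = r ^ 3 \<and> card (carrier (F q)) = q \<and>
        card E = r ^ 4 \<and> 2 * card (distance_set (F q) E) \<le> r ^ 3 + 3 * r ^ 2"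
      using q F(2) by (intro exI[of _ E] exI[of _ r]) (intro conjI)
  qed
  obtain E where "\<forall>q\<in>Q. \<exists>r. E q \<subseteq> plane (F q) \<and> r \<ge> 4 \<and> q = r ^ 3 \<and>
      card (carrier (F q)) = q \<and> card (E q) = r ^ 4 \<and>
      2 * card (distance_set (F q) (E q)) \<le> r ^ 3 + 3 * r ^ 2"
    using bchoice[OF ex] by (rule exE)
  then obtain r where r: "\<forall>q\<in>Q. E q \<subseteq> plane (F q) \<and> r q \<ge> 4 \<and> q = r q ^ 3 \<and>
      card (carrier (F q)) = q \<and> card (E q) = r q ^ 4 \<and>
      2 * card (distance_set (F q) (E q)) \<le> r q ^ 3 + 3 * r q ^ 2"
    by (rule bchoice[THEN exE])
  have E: "E q \<subseteq> plane (F q)" and r4: "r q \<ge> 4" and q: "q = r q ^ 3"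
    and cardF: "card (carrier (F q)) = q" and cardE: "card (E q) = r q ^ 4"
    and cardD: "2 * card (distance_set (F q) (E q)) \<le> r q ^ 3 + 3 * r q ^ 2"
    if "q \<in> Q" for q
    using bspec[OF r that] by blast+
  have root: "real q powr (1 / 3) = real (r q)" if "q \<in> Q" for q
  proof -
    have "real q = real (r q) ^ 3"
      using arg_cong[OF q[OF that], of real] unfolding of_nat_power .
    also have "\<dots> = real (r q) powr 3" using r4[OF that] by simp
    finally have "real q powr (1 / 3) = (real (r q) powr 3) powr (1 / 3)" by (rule arg_cong)
    then show ?thesis unfolding powr_powr using r4[OF that] by simp
  qed
  have card: "real (card (E q)) = real q powr (4 / 3)" if "q \<in> Q" for q
  proof -
    have "real q powr (4 / 3) = (real q powr (1 / 3)) powr 4" by (simp add: powr_powr)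
    also have "\<dots> = real (r q) ^ 4"
      unfolding root[OF that] using r4[OF that] by (simp add: powr_numeral)
    finally show ?thesis using cardE[OF that] by simp
  qed
  have ne: "distance_set (F q) (E q) \<noteq> carrier (F q)" if "q \<in> Q" for q
  proof
    assume eq: "distance_set (F q) (E q) = carrier (F q)"
    \<comment> \<open>If every field element were a distance, there would be \<open>r^3\<close> of
      them, contradicting the bound as soon as \<open>r > 3\<close>.\<close>
    have "2 * r q ^ 3 \<le> r q ^ 3 + 3 * r q ^ 2"
      using cardD[OF that] q[OF that] unfolding eq cardF[OF that] by linarith
    moreover have "3 * r q ^ 2 < r q * r q ^ 2"
      using r4[OF that] by (intro mult_strict_right_mono) auto
    ultimately show False by (simp add: power2_eq_square power3_eq_cube)
  qed
  have bound: "real (card (distance_set (F q) (E q))) / real q \<le> 1 / 2 + 3 / 2 * real q powr (- 1 / 3)"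
    if "q \<in> Q" for q
  proof -
    have r0: "real (r q) > 0" using r4[OF that] by simp
    have "2 * real (card (distance_set (F q) (E q))) \<le> real (r q) ^ 3 + 3 * real (r q) ^ 2"
      using of_nat_mono[OF cardD[OF that], where 'a = real] by simp
    moreover have "real q = real (r q) ^ 3" 
      using arg_cong[OF q[OF that], of real] unfolding of_nat_power .
    ultimately have "real (card (distance_set (F q) (E q))) / real q
        \<le> (real (r q) ^ 3 + 3 * real (r q) ^ 2) / 2 / real (r q) ^ 3"
      using r0 by (intro frac_le) auto
    \<comment> \<open>The error term is of order \<open>1 / r\<close>, that is, \<open>q\<close> to
      the power \<open>-1/3\<close>, and so tends to zero.\<close>
    also have "\<dots> = 1 / 2 + 3 / 2 * (1 / real (r q))"
      using r0 by (simp add: field_simps power2_eq_square power3_eq_cube)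
    also have "1 / real (r q) = real q powr (- 1 / 3)"
      by (simp add: root[OF that, symmetric] powr_minus_divide)
    finally show ?thesis .
  qed
  have "((\<lambda>q::nat. real q powr (- 1 / 3)) \<longlongrightarrow> 0) at_top"
    by (rule tendsto_neg_powr) (auto intro: filterlim_real_sequentially)
  then have "((\<lambda>q::nat. 1 / 2 + 3 / 2 * real q powr (- 1 / 3)) \<longlongrightarrow> 1 / 2 + 3 / 2 * 0) at_top"
    by (intro tendsto_intros)
  then have "((\<lambda>q::nat. 1 / 2 + 3 / 2 * real q powr (- 1 / 3)) \<longlongrightarrow> 1 / 2) at_top"
    by simp
  then have "Limsup (inf at_top (principal Q))
      (\<lambda>q. ereal (real (card (distance_set (F q) (E q))) / real q)) \<le> ereal (1 / 2)"
    using inf bound by (intro Limsup_principal_le_of_tendsto)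
  then show ?thesis
    using inf Qsub E card ne by (intro exI[of _ Q] exI[of _ E]) blast
qed

end
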